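(* Let $p_1$ be a prime, $m\ge 1$, $N=2p_1^m$, and let $p\equiv 3\pmod 4$ be a prime such that $2\in\langle p\rangle\subseteq(\mathbb{Z}/p_1^m\mathbb{Z})^\ast$, $\gcd(p_1,p-1)=1$, and $f:=\mathrm{ord}_N(p)$ is odd. Let $s$ be any odd integer, $q=p^{fs}$, $\omega$ a primitive element of $\mathbb{F}_q$, and $I$ any subset of $\mathbb{Z}/N\mathbb{Z}$ with $\{i\bmod p_1^m: i\in I\}=\mathbb{Z}/p_1^m\mathbb{Z}$. Then $D=\bigcup_{i\in I}\omega^i\langle\omega^N\rangle$ is a skew Hadamard difference set in $(\mathbb{F}_q,+)$.
   Context: A subset $D$ of a finite additive group $G$ of order $v$ with $|D|=k$ is a $(v,k,\lambda)$ difference set if every nonzero element of $G$ occurs exactly $\lambda$ times as a difference $x-y$ with $x,y\in D$, $x\ne y$. A difference set $D$ is skew Hadamard if $G$ is the disjoint union of $D$, $-D$ and $\{0\}$. $\langle\omega^N\rangle$ is the multiplicative subgroup generated by $\omega^N$ and $\mathrm{ord}_N(p)$ is the multiplicative order of $p$ modulo $N$.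
   Formalization: The formal theorem adds |I| = p_1^m, so I has exactly one representative of each class mod p_1^m; without it the claim is false (I = Z/NZ gives D = F_q^*, which equals -D), and larger I never give a skew set. *)

theory Defs
  imports "HOL-Library.Cardinality" "HOL-Number_Theory.Number_Theory" "HOL-Algebra.Generated_Groups"
begin

definition difference_set :: "nat \<Rightarrow> nat \<Rightarrow> nat \<Rightarrow> 'a::{group_add,finite} set \<Rightarrow> bool" where
  "difference_set v k l D \<longleftrightarrow>
     CARD('a) = v \<and> card D = k \<and>
     (\<forall>g. g \<noteq> 0 \<longrightarrow> card {(x, y). x \<in> D \<and> y \<in> D \<and> x \<noteq> y \<and> x - y = g} = l)"

definition skew_hadamard_difference_set :: "'a::{group_add,finite} set \<Rightarrow> bool" where
  "skew_hadamard_difference_set D \<longleftrightarrow>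
     (\<exists>v k l. difference_set v k l D) \<and>
     D \<union> uminus ` D \<union> {0} = UNIV \<and> D \<inter> uminus ` D = {} \<and> 0 \<notin> D \<and> 0 \<notin> uminus ` D"

text \<open>Meant for \<open>g \<noteq> 0\<close>; for \<open>g = 0\<close> the value is the junk set \<open>{0, 1}\<close>.\<close>

definition mult_span :: "'a::field \<Rightarrow> 'a set" where
  "mult_span g = range (\<lambda>k::int. g powi k)"

text \<open>Only nonzero elements qualify, since \<open>0 \<in> mult_span 0\<close>.\<close>

definition primitive_element :: "'a::field \<Rightarrow> bool" where
  "primitive_element w \<longleftrightarrow> mult_span w = UNIV - {0}"

text \<open>The subgroup generated by the class of \<open>a\<close> in the unit group of the integers modulo \<open>n\<close>,
  consisting of canonical representatives in \<open>{0..n-1}\<close>. Meant for \<open>a\<close> coprime to \<open>n\<close>.\<close>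

definition unit_span :: "nat \<Rightarrow> nat \<Rightarrow> int set" where
  "unit_span n a = generate (units_of (residue_ring (int n))) {int a mod int n}"

text \<open>The class \<open>i\<close> modulo \<open>N\<close> is represented by a natural number; if \<open>w \<noteq> 0\<close>, the coset
  \<open>w ^ i * mult_span (w ^ N)\<close> does not depend on the representative.\<close>

definition cyclotomic_union :: "nat \<Rightarrow> 'a::field \<Rightarrow> nat set \<Rightarrow> 'a set" where
  "cyclotomic_union N w I = (\<Union>i\<in>I. (\<lambda>x. w ^ i * x) ` mult_span (w ^ N))"

end

theory Submission
  imports Defs Complex_Main "HOL-Computational_Algebra.Polynomial"
begin

text \<open>
  Let \<open>P = N / 2\<close>, let \<open>H\<close> be the group of nonzero \<open>P\<close>-th powers, \<open>\<psi>\<close> the canonical additive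
  character, \<open>\<eta>\<close> the quadratic character and \<open>G\<close> its Gauss sum. The sign function \<open>g\<close> of \<open>D\<close>
  (1 on \<open>D\<close>, -1 on \<open>-D\<close>, 0 at 0) satisfies \<open>g (x h) = g x * \<eta> h\<close> for \<open>h \<in> H\<close>. The point is that
  the Gauss sum of \<open>\<eta> \<chi>\<close> equals \<open>G\<close> for every \<open>\<chi>\<close> trivial on \<open>H\<close>: in the Davenport--Hasse
  relation \<open>G(\<chi>) G(\<chi> \<eta>) = \<chi>(4)\<^sup>-\<^sup>1 G(\<chi>\<^sup>2) G\<close> one has \<open>\<chi>(4) = 1\<close>, because \<open>P\<close> is coprime to \<open>p - 1\<close>, and
  \<open>G(\<chi>\<^sup>2) = G(\<chi>)\<close>, because 2 is a power of \<open>p\<close> modulo \<open>P\<close>. Hence the Fourier transform of \<open>g\<close> at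
  \<open>c\<close> is \<open>G * g (1 / c)\<close>, which has constant absolute value off 0, and the autocorrelations of \<open>g\<close> off 0
  are all \<open>-1\<close>. Multiplicative characters are avoided by working with sums over cosets of \<open>H\<close>;
  the Davenport--Hasse relation then takes the form of the evaluation of Salie sums.
\<close>

section \<open>The canonical additive character of a finite field\<close>

locale additive_character =
  fixes \<psi> :: "'a::{field,finite} \<Rightarrow> complex"
  assumes psi_add: "\<psi> (x + y) = \<psi> x * \<psi> y"
    and psi_zero: "\<psi> 0 = 1"
    and psi_nontrivial: "\<exists>x. \<psi> x \<noteq> 1"
begin

text \<open>Translating \<open>x\<close> by \<open>u / b\<close> multiplies the sum by
  \<open>\<psi> u\<close>, which differs from 1; so the sum vanishes for
  \<open>b \<noteq> 0\<close>.\<close>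

lemma sum_psi: "(\<Sum>x\<in>UNIV. \<psi> (b * x)) = (if b = 0 then of_nat CARD('a) else 0)"
proof (cases "b = 0")
  case False
  obtain u where u: "\<psi> u \<noteq> 1" using psi_nontrivial by blast
  have "(\<Sum>x\<in>UNIV. \<psi> (b * x)) = (\<Sum>x\<in>UNIV. \<psi> (b * (x + u / b)))"
    by (rule sum.reindex_bij_witness[of _ "\<lambda>x. x + u / b" "\<lambda>x. x - u / b"]) auto
  also have "\<dots> = (\<Sum>x\<in>UNIV. \<psi> (b * x)) * \<psi> u"
    unfolding sum_distrib_right
    by (intro sum.cong) (use False in \<open>auto simp: psi_add distrib_left\<close>)
  finally show ?thesis using u False by auto
qed (simp add: psi_zero)

lemma sum_psi_nonzero:
  "(\<Sum>x\<in>-{0}. \<psi> (b * x)) = (if b = 0 then of_nat CARD('a) else 0) - 1"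
proof -
  have "(\<Sum>x\<in>UNIV. \<psi> (b * x)) = \<psi> (b * 0) + (\<Sum>x\<in>UNIV - {0}. \<psi> (b * x))"
    by (rule sum.remove) auto
  then show ?thesis by (simp add: sum_psi psi_zero Compl_eq_Diff_UNIV)
qed

end

section \<open>The prime field, the trace and its additive character\<close>

lemma finite_field_CHAR:
  assumes "prime p" "CARD('a::{field,finite}) = p ^ n"
  shows "CHAR('a) = p"
proof -
  have "prime CHAR('a)"
    using prime_CHAR_semidom[where ?'a = 'a] finite_imp_CHAR_pos[where ?'a = 'a] by simp
  moreover have "CHAR('a) dvd p ^ n" using CHAR_dvd_CARD[where ?'a = 'a] assms(2) by simp
  ultimately show ?thesis using assms(1) prime_dvd_power primes_dvd_imp_eq by blast
qed

text \<open>Multiplication by \<open>x\<close> permutes the nonzero elements, so their product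
  absorbs this power of \<open>x\<close>.\<close>

lemma finite_field_power_card_minus_1:
  fixes x :: "'a::{field,finite}"
  assumes "x \<noteq> 0"
  shows "x ^ (CARD('a) - 1) = 1"
proof -
  have "(\<Prod>y\<in>-{0}. y) = (\<Prod>y\<in>-{0}. x * y)"
    by (rule prod.reindex_bij_witness[of _ "\<lambda>y. x * y" "\<lambda>y. y / x"]) (use assms in auto)
  also have "\<dots> = x ^ card (-{0::'a}) * (\<Prod>y\<in>-{0}. y)"
    by (simp add: prod.distrib)
  finally have "x ^ card (-{0::'a}) = 1" by simp
  then show ?thesis by (simp add: Compl_eq_Diff_UNIV card_Diff_singleton)
qed

text \<open>The images of the naturals below \<open>p = CHAR('a)\<close> are \<open>p\<close>
  distinct roots of \<open>X^p - X\<close>, which has at most \<open>p\<close> roots.\<close>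

lemma prime_field_elements:
  assumes "prime CHAR('a::field)"
  shows "{z::'a. z ^ CHAR('a) = z} = of_nat ` {..<CHAR('a)}"
proof (rule card_subset_eq[symmetric])
  let ?p = "CHAR('a)"
  let ?P = "Polynomial.monom 1 ?p - Polynomial.monom 1 1 :: 'a poly"
  have p2: "?p \<ge> 2" using assms by (rule prime_ge_2_nat)
  have "Polynomial.coeff ?P ?p = 1" using p2 by simp
  then have "?P \<noteq> 0" by (metis coeff_0 zero_neq_one)
  have R: "{z::'a. z ^ ?p = z} = {z. poly ?P z = 0}" by (simp add: poly_monom)
  then show fin: "finite {z::'a. z ^ ?p = z}" using poly_roots_finite[OF \<open>?P \<noteq> 0\<close>] by simp
  show sub: "of_nat ` {..<?p} \<subseteq> {z::'a. z ^ ?p = z}"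
  proof -
    have "(of_nat k :: 'a) ^ ?p = of_nat k" for k
      using p2 assms by (induction k) (simp_all add: freshmans_dream power_0_left)
    then show ?thesis by auto
  qed
  have inj: "inj_on (of_nat :: nat \<Rightarrow> 'a) {..<?p}"
    by (auto simp: inj_on_def of_nat_eq_iff_cong_CHAR cong_less_modulus_unique_nat)
  have "card {z::'a. z ^ ?p = z} \<le> degree ?P"
    unfolding R by (rule card_poly_roots_bound) fact
  also have "degree ?P \<le> ?p" using p2 by (intro degree_diff_le) (auto simp: degree_monom_eq)
  also have "?p = card ((of_nat :: nat \<Rightarrow> 'a) ` {..<?p})" using inj by (simp add: card_image)
  finally show "card ((of_nat :: nat \<Rightarrow> 'a) ` {..<?p}) = card {z::'a. z ^ ?p = z}"
    using card_mono[OF fin sub] by (rule le_antisym[rotated])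
qed

text \<open>The sum is the trace to the field with \<open>p\<close> elements when \<open>p\<close>
  is prime. As a polynomial it has degree \<open>p ^ (n - 1)\<close>, less than the size of the
  field, so it cannot vanish everywhere.\<close>

lemma power_sum_not_vanishing:
  assumes "1 < p" "0 < n" "CARD('a::{field,finite}) = p ^ n"
  shows "\<exists>x::'a. (\<Sum>i<n. x ^ (p ^ i)) \<noteq> 0"
proof (rule ccontr)
  assume neg: "\<not> ?thesis"
  let ?P = "\<Sum>i<n. Polynomial.monom 1 (p ^ i) :: 'a poly"
  have "p ^ i = p ^ (n - 1) \<longleftrightarrow> i = n - 1" for i using assms(1) by simp
  then have "Polynomial.coeff ?P (p ^ (n - 1)) = (\<Sum>i<n. if i = n - 1 then 1 else 0)"
    by (simp add: coeff_sum)
  also have "\<dots> = 1" using assms(2) by simp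
  finally have "?P \<noteq> 0" by auto
  have "poly ?P x = 0" for x using neg by (simp add: poly_sum poly_monom)
  then have "CARD('a) \<le> degree ?P" using card_poly_roots_bound[OF \<open>?P \<noteq> 0\<close>] by simp
  also have "\<dots> \<le> p ^ (n - 1)"
  proof (rule degree_sum_le)
    fix i assume "i \<in> {..<n}"
    then have "p ^ i \<le> p ^ (n - 1)" using assms(1) by (intro power_increasing) auto
    then show "degree (Polynomial.monom 1 (p ^ i) :: 'a poly) \<le> p ^ (n - 1)" by (simp add: degree_monom_eq)
  qed simp
  also have "\<dots> < p ^ n" using assms by simp
  finally show False using assms by simp
qed

lemma power_eq_of_cong:
  fixes z :: "'a::monoid_mult"
  assumes "z ^ n = 1" "[a = b] (mod n)"
  shows "z ^ a = z ^ b"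
proof -
  have "z ^ c = z ^ (c mod n)" for c
  proof -
    have "z ^ c = z ^ (n * (c div n) + c mod n)" by simp
    also have "\<dots> = z ^ (c mod n)" unfolding power_add power_mult assms(1) by simp
    finally show ?thesis .
  qed
  then show ?thesis using assms(2) unfolding cong_def by metis
qed

lemma cis_root_neq_1:
  assumes "1 < p"
  shows "cis (2 * pi / real p) \<noteq> 1"
proof (cases "p = 2")
  case False
  then have "p > 2" using assms by simp
  then have "sin (2 * pi / real p) > 0"
    by (intro sin_gt_zero) (simp_all add: field_simps)
  then show ?thesis by (auto simp: complex_eq_iff)
qed (simp add: complex_eq_iff)

text \<open>The character is \<open>\<zeta>\<close> to the power of the trace, with
  \<open>\<zeta>\<close> a primitive \<open>p\<close>-th root of unity. The trace is fixed by
  Frobenius, hence lies in the prime field and lifts to a natural number \<open>t x\<close>; the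
  power of \<open>\<zeta>\<close> does not depend on the lift.\<close>

lemma exists_trace_character:
  assumes "prime p" "0 < n" "CARD('a::{field,finite}) = p ^ n"
  shows "\<exists>\<psi> :: 'a \<Rightarrow> complex. additive_character \<psi> \<and> (\<forall>x. \<psi> (x ^ p) = \<psi> x)"
proof -
  have char: "CHAR('a) = p" by (rule finite_field_CHAR[OF assms(1,3)])
  have pc: "prime CHAR('a)" using assms(1) char by simp
  have p1: "p > 1" using assms(1) by (rule prime_gt_1_nat)
  define T :: "'a \<Rightarrow> 'a" where "T x = (\<Sum>i<n. x ^ (p ^ i))" for x
  have T_add: "T (x + y) = T x + T y" for x y
    unfolding T_def by (simp add: freshmans_dream'[OF pc] char sum.distrib)
  have card_pow: "x ^ p ^ n = x" for x :: 'a
  proof (cases "x = 0")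
    case False
    have "x ^ p ^ n = x * x ^ (p ^ n - 1)"
      using p1 by (metis Suc_pred' power_Suc zero_less_power zero_less_one order_less_trans One_nat_def)
    then show ?thesis using finite_field_power_card_minus_1[OF False] assms(3) by simp
  qed (use p1 in \<open>simp add: power_0_left\<close>)
  have T_frob: "T (x ^ p) = T x" for x
  proof -
    have "T (x ^ p) = (\<Sum>i<n. x ^ (p ^ Suc i))"
      by (simp add: T_def flip: power_mult)
    \<comment> \<open>The last term gained is \<open>x ^ p ^ n = x\<close>, the same as the first
      term lost: Frobenius permutes the summands cyclically.\<close>
    also have "\<dots> = (\<Sum>i<Suc n. x ^ (p ^ i)) - x"
      unfolding sum.lessThan_Suc_shift by simp
    also have "\<dots> = T x" by (simp add: T_def card_pow)
    finally show ?thesis .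
  qed
  have "T x ^ p = T (x ^ p)" for x
    unfolding T_def by (simp add: freshmans_dream_sum[OF pc] char mult.commute flip: power_mult)
  then have "T x \<in> {z. z ^ p = z}" for x
    by (simp add: T_frob)
  then have "T x \<in> of_nat ` {..<p}" for x
    using prime_field_elements[OF pc, unfolded char] by simp
  then have "\<forall>x. \<exists>k. of_nat k = T x" by (metis imageE)
  then obtain t where t: "of_nat (t x) = T x" for x unfolding choice_iff by blast
  define \<zeta> where "\<zeta> = cis (2 * pi / real p)"
  have \<zeta>: "\<zeta> ^ p = 1" "\<zeta> \<noteq> 1"
    using p1 cis_root_neq_1[OF p1] by (simp_all add: \<zeta>_def DeMoivre)
  have eqI: "\<zeta> ^ a = \<zeta> ^ b" if "(of_nat a :: 'a) = of_nat b" for a b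
    using that \<zeta>(1) power_eq_of_cong by (simp add: of_nat_eq_iff_cong_CHAR char)
  obtain x where x: "T x \<noteq> 0"
    using power_sum_not_vanishing[OF p1 assms(2,3)] by (auto simp: T_def)
  \<comment> \<open>A nonzero trace makes \<open>t x\<close> invertible modulo \<open>p\<close>, so
    \<open>\<zeta> ^ t x = 1\<close> would force \<open>\<zeta> = 1\<close>.\<close>
  have "\<zeta> ^ t x \<noteq> 1"
  proof
    assume one: "\<zeta> ^ t x = 1"
    have "\<not> p dvd t x" using x t[of x] by (metis char of_nat_eq_0_iff_char_dvd)
    then have "coprime (t x) p" using assms(1) by (metis coprime_commute prime_imp_coprime)
    then obtain k where "[t x * k = Suc 0] (mod p)" using cong_solve_coprime_nat by blast
    then have "\<zeta> ^ (t x * k) = \<zeta> ^ Suc 0" by (rule power_eq_of_cong[OF \<zeta>(1)])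
    then show False using one \<zeta>(2) by (simp add: power_mult)
  qed
  moreover have "\<zeta> ^ t (x + y) = \<zeta> ^ t x * \<zeta> ^ t y" for x y
    unfolding power_add[symmetric] by (rule eqI) (simp add: t T_add)
  moreover have "\<zeta> ^ t 0 = \<zeta> ^ 0"
    by (rule eqI) (use p1 in \<open>simp add: t T_def power_0_left\<close>)
  moreover have "\<zeta> ^ t (x ^ p) = \<zeta> ^ t x" for x
    by (rule eqI) (simp add: t T_frob)
  ultimately show ?thesis
    by (intro exI[of _ "\<lambda>x. \<zeta> ^ t x"]) (auto simp: additive_character_def)
qed

section \<open>Salie sums\<close>

text \<open>The condition \<open>\<eta> (-1) = -1\<close> makes -1 a nonsquare, as it is in fields
  of order 3 modulo 4. It also excludes characteristic 2, which allows division by 2 and 4.\<close>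

locale quadratic_gauss = additive_character \<psi> for \<psi> :: "'a::{field,finite} \<Rightarrow> complex" +
  fixes \<eta> :: "'a \<Rightarrow> complex"
  assumes eta_zero [simp]: "\<eta> 0 = 0"
    and eta_mult: "\<eta> (x * y) = \<eta> x * \<eta> y"
    and eta_eq_1_iff: "x \<noteq> 0 \<Longrightarrow> \<eta> x = 1 \<longleftrightarrow> (\<exists>y. x = y\<^sup>2)"
    and eta_cases: "x \<noteq> 0 \<Longrightarrow> \<eta> x = 1 \<or> \<eta> x = -1"
    and eta_minus_1: "\<eta> (-1) = -1"
begin

definition gauss_sum :: complex where
  "gauss_sum = (\<Sum>x\<in>UNIV. \<eta> x * \<psi> x)"

lemma eta_1 [simp]: "\<eta> 1 = 1"
  using eta_eq_1_iff[of 1] by (metis one_neq_zero one_power2)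

lemma eta_minus: "\<eta> (- x) = - \<eta> x"
  using eta_mult[of "-1" x] by (simp add: eta_minus_1)

lemma two_neq_0 [simp]: "(2::'a) \<noteq> 0"
proof
  assume "(2::'a) = 0"
  then have "(1::'a) = -1" by (metis add_eq_0_iff one_add_one)
  then have "\<eta> (1::'a) = \<eta> (-1)" by (rule arg_cong)
  then show False by (simp add: eta_minus_1)
qed

lemma four_neq_0 [simp]: "(4::'a) \<noteq> 0"
  using two_neq_0 by (metis mult_eq_0_iff numeral_Bit0_eq_double)

lemma eta_square [simp]: "x \<noteq> 0 \<Longrightarrow> \<eta> x * \<eta> x = 1"
  using eta_cases[of x] by auto

lemma eta_square_left [simp]: "x \<noteq> 0 \<Longrightarrow> \<eta> x * (\<eta> x * z) = z"
  using eta_square[of x] by (simp flip: mult.assoc)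

lemma eta_inverse: "\<eta> (inverse x) = \<eta> x"
proof (cases "x = 0")
  case False
  then have "\<eta> x * \<eta> (inverse x) = 1" by (simp flip: eta_mult)
  then show ?thesis
    using eta_cases[OF False] eta_cases[of "inverse x"] False by auto
qed simp

lemma eta_divide: "\<eta> (x / y) = \<eta> x * \<eta> y"
  by (simp add: divide_inverse eta_mult eta_inverse)

lemma eta_eqI:
  assumes "x * y = z\<^sup>2" "z \<noteq> 0"
  shows "\<eta> x = \<eta> y"
proof -
  have "x \<noteq> 0" "y \<noteq> 0" using assms by auto
  have "\<eta> x * \<eta> y = \<eta> z * \<eta> z"
    using assms(1) by (metis eta_mult power2_eq_square)
  then show ?thesis
    using eta_cases[OF \<open>x \<noteq> 0\<close>] eta_cases[OF \<open>y \<noteq> 0\<close>] assms(2) by auto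
qed

lemma sum_eta_psi: "(\<Sum>x\<in>UNIV. \<eta> x * \<psi> (d * x)) = \<eta> d * gauss_sum" if "d \<noteq> 0"
proof -
  have "gauss_sum = (\<Sum>x\<in>UNIV. \<eta> (d * x) * \<psi> (d * x))"
    unfolding gauss_sum_def
    by (rule sum.reindex_bij_witness[of _ "\<lambda>x. d * x" "\<lambda>x. x / d"]) (use that in auto)
  also have "\<dots> = \<eta> d * (\<Sum>x\<in>UNIV. \<eta> x * \<psi> (d * x))"
    by (simp add: eta_mult sum_distrib_left mult_ac)
  finally show ?thesis using that by (simp flip: mult.assoc)
qed

text \<open>The fibre consists of the roots of \<open>y^2 - t y + 1\<close>, with discriminant
  \<open>(t + 2) * (t - 2)\<close> and root product 1. For a root, \<open>y * (t + 2)\<close> and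
  \<open>y * (t - 2)\<close> are the squares of \<open>y + 1\<close> and \<open>y - 1\<close>, so
  off \<open>t = 2\<close> and \<open>t = -2\<close> both terms on the right equal
  \<open>\<eta> y\<close>.\<close>

lemma sum_eta_fibre:
  "(\<Sum>y | y \<noteq> 0 \<and> y + 1 / y = t. \<eta> y) = \<eta> (t + 2) + \<eta> (t - 2)"
proof -
  let ?Y = "{y. y \<noteq> 0 \<and> y + 1 / y = t}"
  have quad: "y + 1 / y = t \<longleftrightarrow> y * y + 1 = t * y" if "y \<noteq> 0" for y
    using that by (auto simp: field_simps)
  show ?thesis
  proof (cases "t = 2 \<or> t = -2")
    case True
    \<comment> \<open>Here \<open>e\<close> is a double root. One term on the right is
      \<open>\<eta> 0 = 0\<close>, the other is \<open>\<eta> (4 * e) = \<eta> e\<close>.\<close>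
    then obtain e :: 'a where e: "e\<^sup>2 = 1" "t = 2 * e" "e = 1 \<or> e = -1"
      using that[of 1] that[of "-1"] by auto
    have "y * y + 1 = t * y \<longleftrightarrow> (y - e)\<^sup>2 = 0" for y
      using e by (auto simp: power2_eq_square algebra_simps)
    then have "?Y = {e}" using quad e by auto
    then have "(\<Sum>y | y \<noteq> 0 \<and> y + 1 / y = t. \<eta> y) = \<eta> e" by simp
    also have "\<eta> (4::'a) = 1"
      using eta_eqI[of 4 1 2] by simp
    then have "\<eta> e = \<eta> (t + 2) + \<eta> (t - 2)"
      using e(2,3) eta_minus[of 4] eta_minus_1 by (elim disjE) simp_all
    finally show ?thesis .
  next
    case False
    have plus: "\<eta> y = \<eta> (t + 2)" if "y \<in> ?Y" for y
    proof (rule eta_eqI)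
      show "y * (t + 2) = (y + 1)\<^sup>2"
        using that quad[of y] by (simp add: power2_eq_square algebra_simps)
      show "y + 1 \<noteq> 0" using that False by (auto simp: add_eq_0_iff2)
    qed
    have minus: "\<eta> y = \<eta> (t - 2)" if "y \<in> ?Y" for y
    proof (rule eta_eqI)
      show "y * (t - 2) = (y - 1)\<^sup>2"
        using that quad[of y] by (simp add: power2_eq_square algebra_simps)
      show "y - 1 \<noteq> 0" using that False by auto
    qed
    have nz: "t + 2 \<noteq> 0" "t - 2 \<noteq> 0" using False by (auto simp: add_eq_0_iff2)
    show ?thesis
    proof (cases "?Y = {}")
      case True
      \<comment> \<open>Equal signs would make the discriminant a square \<open>s^2\<close>, and
        \<open>(t + s) / 2\<close> would be a root. With opposite signs the right-hand side is
        0.\<close>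
      have "\<eta> (t + 2) \<noteq> \<eta> (t - 2)"
      proof
        assume "\<eta> (t + 2) = \<eta> (t - 2)"
        then have "\<eta> ((t + 2) * (t - 2)) = 1" using nz by (simp add: eta_mult)
        then obtain s where s: "(t + 2) * (t - 2) = s\<^sup>2"
          using nz eta_eq_1_iff[of "(t + 2) * (t - 2)"] by auto
        define y where "y = (t + s) / 2"
        have y2: "2 * y = t + s" by (simp add: y_def)
        have "4 * (y * y + 1) = 4 * (t * y)"
        proof -
          have "(t + s) * (t + s) + 4 - 2 * t * (t + s) = s\<^sup>2 - (t + 2) * (t - 2)"
            by (simp add: algebra_simps power2_eq_square)
          then have st: "(t + s) * (t + s) + 4 = 2 * t * (t + s)" using s by simp
          have "4 * (y * y + 1) = (2 * y) * (2 * y) + 4" by (simp add: algebra_simps)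
          also have "\<dots> = (t + s) * (t + s) + 4" by (simp only: y2)
          also have "\<dots> = 2 * t * (t + s)" by (rule st)
          also have "\<dots> = 2 * t * (2 * y)" by (simp only: y2)
          finally show ?thesis by simp
        qed
        then have "y * y + 1 = t * y" by (subst (asm) mult_cancel_left) simp
        moreover from this have "y \<noteq> 0" by auto
        ultimately have "y \<in> ?Y" using quad by auto
        then show False using True by blast
      qed
      then show ?thesis
        unfolding True using eta_cases[OF nz(1)] eta_cases[OF nz(2)] by auto
    next
      case False
      then obtain y where y: "y \<in> ?Y" by blast
      have Y: "?Y = {y, 1 / y}"
      proof -
        have "z = y \<or> z = 1 / y" if "z \<in> ?Y" for z
        proof -
          have "(z - y) * (z * y - 1) = y * (z * z + 1) - z * (y * y + 1)"
            by (simp add: algebra_simps)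
          also have "\<dots> = 0" using that y quad[of z] quad[of y] by (simp add: mult_ac)
          finally have "z = y \<or> z * y = 1" by (simp only: mult_eq_0_iff right_minus_eq)
          then show ?thesis using y by (auto simp: eq_divide_eq)
        qed
        moreover have "1 / y \<in> ?Y" using y by (simp add: add.commute[of "1 / y"])
        moreover have "A = {a, b}" if "\<And>z. z \<in> A \<Longrightarrow> z = a \<or> z = b" "a \<in> A" "b \<in> A"
          for A and a b :: 'a
          using that by blast
        ultimately show ?thesis using y by presburger
      qed
      moreover have "y \<noteq> 1 / y"
      proof
        assume a: "y = 1 / y"
        then have "y\<^sup>2 = 1" using y by (auto simp: power2_eq_square field_simps)
        then have "y = 1 \<or> y = -1" by (simp add: power2_eq_1_iff)
        then show False using y \<open>\<not> (t = 2 \<or> t = -2)\<close> by auto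
      qed
      ultimately show ?thesis using plus[OF y] minus[of y] y by (simp add: eta_divide)
    qed
  qed
qed

text \<open>If \<open>c\<close> is a nonsquare, the substitution of \<open>c / x\<close> for
  \<open>x\<close> changes the sign of the sum, and no \<open>v\<close> exists. If
  \<open>c = d^2\<close>, scaling \<open>x\<close> by \<open>d\<close> turns the argument of
  \<open>\<psi>\<close> into \<open>d * (y + 1 / y)\<close>; grouping by
  \<open>t = y + 1 / y\<close> leaves two translated Gauss sums, which contribute the values of
  \<open>\<psi>\<close> at the two roots \<open>2 * d\<close> and \<open>- (2 * d)\<close>.\<close>

lemma salie_sum:
  assumes "c \<noteq> 0"
  shows "(\<Sum>x\<in>-{0}. \<eta> x * \<psi> (x + c / x)) = gauss_sum * (\<Sum>v | v\<^sup>2 = 4 * c. \<psi> v)"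
    (is "?S = _")
proof (cases "\<exists>d. c = d\<^sup>2")
  case False
  then have "\<eta> c = -1" using assms eta_cases eta_eq_1_iff by blast
  have "?S = (\<Sum>x\<in>-{0}. \<eta> (c / x) * \<psi> (c / x + x))"
    by (rule sum.reindex_bij_witness[of _ "\<lambda>x. c / x" "\<lambda>x. c / x"]) (use assms in auto)
  also have "\<dots> = - ?S"
    unfolding sum_negf[symmetric]
    by (intro sum.cong) (auto simp: eta_divide \<open>\<eta> c = -1\<close> add.commute)
  finally have "?S = 0" by simp
  moreover have "{v. v\<^sup>2 = 4 * c} = {}"
  proof -
    have "c = (v / 2)\<^sup>2" if "v\<^sup>2 = 4 * c" for v
      using that by (simp add: power_divide)
    then show ?thesis using False by blast
  qed
  ultimately show ?thesis by (simp only: sum.empty mult_zero_right)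
next
  case True
  then obtain d where d: "c = d\<^sup>2" "d \<noteq> 0" using assms by auto
  have shift: "(\<Sum>t\<in>UNIV. \<psi> (d * t) * \<eta> (t + a)) = \<psi> (- d * a) * \<eta> d * gauss_sum" for a
  proof -
    have "(\<Sum>t\<in>UNIV. \<psi> (d * t) * \<eta> (t + a)) = (\<Sum>t\<in>UNIV. \<psi> (- d * a) * (\<eta> t * \<psi> (d * t)))"
      by (rule sum.reindex_bij_witness[of _ "\<lambda>t. t - a" "\<lambda>t. t + a"])
        (auto simp: algebra_simps simp flip: psi_add)
    also have "\<dots> = \<psi> (- d * a) * \<eta> d * gauss_sum"
      using d by (simp add: sum_eta_psi flip: sum_distrib_left)
    finally show ?thesis .
  qed
  have scale: "d * (x / d + 1 / (x / d)) = x + c / x" for x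
    using d by (simp add: distrib_left power2_eq_square)
  have "?S = (\<Sum>y\<in>-{0}. \<eta> (d * y) * \<psi> (d * (y + 1 / y)))"
    by (rule sum.reindex_bij_witness[of _ "\<lambda>y. d * y" "\<lambda>x. x / d"])
      (use d(2) in \<open>simp_all add: scale del: divide_divide_eq_right\<close>)
  also have "\<dots> = (\<Sum>t\<in>UNIV. \<Sum>y | y \<in> -{0} \<and> y + 1 / y = t. \<eta> (d * y) * \<psi> (d * (y + 1 / y)))"
    by (rule sum.group[symmetric]) auto
  also have "\<dots> = (\<Sum>t\<in>UNIV. \<eta> d * (\<psi> (d * t) * (\<Sum>y | y \<noteq> 0 \<and> y + 1 / y = t. \<eta> y)))"
    by (intro sum.cong) (auto simp: sum_distrib_left eta_mult intro!: sum.cong)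
  also have "\<dots> = \<eta> d * ((\<Sum>t\<in>UNIV. \<psi> (d * t) * \<eta> (t + 2)) + (\<Sum>t\<in>UNIV. \<psi> (d * t) * \<eta> (t + (- 2))))"
    by (simp add: sum_eta_fibre sum_distrib_left sum.distrib distrib_left)
  \<comment> \<open>Each translated sum carries a factor \<open>\<eta> d\<close>, which cancels
    against the outer one.\<close>
  also have "\<dots> = gauss_sum * (\<psi> (2 * d) + \<psi> (- (2 * d)))"
    unfolding shift using d by (simp add: algebra_simps)
  also have "\<psi> (2 * d) + \<psi> (- (2 * d)) = (\<Sum>v | v\<^sup>2 = 4 * c. \<psi> v)"
  proof -
    have "v\<^sup>2 = 4 * c \<longleftrightarrow> v\<^sup>2 = (2 * d)\<^sup>2" for v
      using d by (simp add: power_mult_distrib)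
    then have "{v. v\<^sup>2 = 4 * c} = {2 * d, - (2 * d)}"
      unfolding power2_eq_iff by blast
    moreover have "2 * d \<noteq> - (2 * d)"
    proof
      assume "2 * d = - (2 * d)"
      then have "4 * d = 0" by (simp add: eq_neg_iff_add_eq_0)
      then show False using d by simp
    qed
    ultimately show ?thesis by simp
  qed
  finally show ?thesis .
qed

end

section \<open>Gauss sums over the cosets of a subgroup\<close>

text \<open>In the application \<open>H\<close> is the group of nonzero \<open>P\<close>-th powers
  and \<open>\<phi>\<close> a power of Frobenius. \<open>four_in_H\<close> encodes
  \<open>\<chi>(4) = 1\<close> for every \<open>\<chi>\<close> trivial on \<open>H\<close>;
  \<open>phi_square\<close>, with \<open>psi_phi\<close>, encodes that \<open>\<chi>\<close> and its
  square have equal Gauss sums.\<close>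

locale frobenius_coset = quadratic_gauss \<psi> \<eta>
  for \<psi> \<eta> :: "'a::{field,finite} \<Rightarrow> complex" +
  fixes H :: "'a set" and \<phi> :: "'a \<Rightarrow> 'a"
  assumes zero_notin_H: "0 \<notin> H"
    and one_in_H: "1 \<in> H"
    and H_mult: "x \<in> H \<Longrightarrow> y \<in> H \<Longrightarrow> x * y \<in> H"
    and H_inverse: "x \<in> H \<Longrightarrow> inverse x \<in> H"
    and four_in_H: "4 \<in> H"
    and minus_one_in_H: "-1 \<in> H"
    and bij_phi: "bij \<phi>"
    and phi_zero: "\<phi> 0 = 0"
    and psi_phi: "\<psi> (\<phi> x) = \<psi> x"
    and phi_square: "x \<noteq> 0 \<Longrightarrow> \<phi> x / x\<^sup>2 \<in> H"
begin

lemma H_nonzero: "x \<in> H \<Longrightarrow> x \<noteq> 0"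
  using zero_notin_H by auto

lemma H_divide: "x \<in> H \<Longrightarrow> y \<in> H \<Longrightarrow> x / y \<in> H"
  by (simp add: divide_inverse H_mult H_inverse)

lemma H_mult_iff: "x \<in> H \<Longrightarrow> x * y \<in> H \<longleftrightarrow> y \<in> H"
proof
  assume "x \<in> H" "x * y \<in> H"
  then have "(x * y) / x \<in> H" by (rule H_divide[rotated])
  then show "y \<in> H" using H_nonzero[OF \<open>x \<in> H\<close>] by simp
qed (rule H_mult)

lemma card_H_pos: "card H > 0"
  using one_in_H by (auto simp: card_gt_0_iff)

text \<open>The two quotients differ by the factor \<open>4 * \<phi> v / v^2\<close>, an element of
  \<open>H\<close>. For \<open>v = 0\<close> both are 0 and lie outside \<open>H\<close>.\<close>

lemma phi_in_coset_iff: "\<phi> v / c \<in> H \<longleftrightarrow> v\<^sup>2 / (4 * c) \<in> H" if "c \<noteq> 0"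
proof (cases "v = 0")
  case False
  have "\<phi> v / c = (\<phi> v / v\<^sup>2 * 4) * (v\<^sup>2 / (4 * c))"
    using False that by (simp add: field_simps)
  show ?thesis
    unfolding \<open>\<phi> v / c = _\<close>
    by (rule H_mult_iff[OF H_mult[OF phi_square[OF False] four_in_H]])
qed (simp add: phi_zero zero_notin_H)

text \<open>For nonzero \<open>c\<close> this is the Gaussian period of the coset
  \<open>c H\<close>.\<close>

definition period :: "'a \<Rightarrow> complex" where
  "period c = (\<Sum>h\<in>H. \<psi> (c * h))"

text \<open>Averaging the Salie sum over a coset of \<open>H\<close>; this replaces the Davenport--Hasse
  product formula for all the characters trivial on \<open>H\<close> at once.\<close>

lemma period_convolution:
  assumes "c \<noteq> 0"
  shows "(\<Sum>x\<in>-{0}. \<eta> x * \<psi> x * period (c / x)) = gauss_sum * period c"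
proof -
  let ?V = "{v. v\<^sup>2 / (4 * c) \<in> H}"
  have "(\<Sum>x\<in>-{0}. \<eta> x * \<psi> x * period (c / x)) = (\<Sum>x\<in>-{0}. \<Sum>h\<in>H. \<eta> x * \<psi> (x + (c * h) / x))"
    unfolding period_def by (simp add: sum_distrib_left psi_add mult_ac)
  also have "\<dots> = (\<Sum>h\<in>H. \<Sum>x\<in>-{0}. \<eta> x * \<psi> (x + (c * h) / x))"
    by (rule sum.swap)
  also have "\<dots> = (\<Sum>h\<in>H. gauss_sum * (\<Sum>v | v\<^sup>2 = 4 * (c * h). \<psi> v))"
    by (intro sum.cong salie_sum) (use assms H_nonzero in auto)
  also have "\<dots> = gauss_sum * (\<Sum>h\<in>H. \<Sum>v | v \<in> ?V \<and> v\<^sup>2 / (4 * c) = h. \<psi> v)"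
  proof -
    have "{v. v\<^sup>2 = 4 * (c * h)} = {v. v \<in> ?V \<and> v\<^sup>2 / (4 * c) = h}" if "h \<in> H" for h
      using that assms by (auto simp: divide_eq_eq mult_ac)
    then show ?thesis by (simp add: sum_distrib_left)
  qed
  also have "(\<Sum>h\<in>H. \<Sum>v | v \<in> ?V \<and> v\<^sup>2 / (4 * c) = h. \<psi> v) = (\<Sum>v\<in>?V. \<psi> v)"
    by (rule sum.group) auto
  \<comment> \<open>Since \<open>\<phi>\<close> is a bijection carrying \<open>?V\<close> onto the
    coset \<open>c H\<close> and preserving \<open>\<psi>\<close>, the sum over a preimage under
    squaring becomes the period itself.\<close>
  also have "\<dots> = (\<Sum>h\<in>H. \<psi> (c * h))"
  proof (rule sum.reindex_bij_witness[of _ "\<lambda>h. inv_into UNIV \<phi> (c * h)" "\<lambda>v. \<phi> v / c"])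
    fix v assume "v \<in> ?V"
    then show "\<phi> v / c \<in> H" by (simp add: phi_in_coset_iff[OF assms])
    show "inv_into UNIV \<phi> (c * (\<phi> v / c)) = v" using assms bij_phi by (simp add: bij_is_inj)
    show "\<psi> (c * (\<phi> v / c)) = \<psi> v" using assms by (simp add: psi_phi)
  next
    fix h assume "h \<in> H"
    moreover have *: "\<phi> (inv_into UNIV \<phi> (c * h)) = c * h"
      using bij_phi by (simp add: bij_is_surj surj_f_inv_f)
    ultimately show "inv_into UNIV \<phi> (c * h) \<in> ?V"
      using phi_in_coset_iff[OF assms, of "inv_into UNIV \<phi> (c * h)"] assms by simp
    show "\<phi> (inv_into UNIV \<phi> (c * h)) / c = h" using * assms by simp
  qed
  finally show ?thesis unfolding period_def .
qed

text \<open>Orthogonality selects the \<open>h\<close> with \<open>h * y = b\<close>, at most one;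
  leaving out \<open>c = 0\<close> costs 1 for each \<open>h\<close>, which gives
  \<open>- card H\<close>.\<close>

lemma sum_psi_period:
  "(\<Sum>c\<in>-{0}. \<psi> (- b * c) * period (c * y))
     = (if y \<noteq> 0 \<and> b / y \<in> H then of_nat CARD('a) else 0) - of_nat (card H)"
  if "b \<noteq> 0"
proof -
  have "(\<Sum>c\<in>-{0}. \<psi> (- b * c) * period (c * y)) = (\<Sum>c\<in>-{0}. \<Sum>h\<in>H. \<psi> ((h * y - b) * c))"
    unfolding period_def by (simp add: sum_distrib_left algebra_simps flip: psi_add)
  also have "\<dots> = (\<Sum>h\<in>H. \<Sum>c\<in>-{0}. \<psi> ((h * y - b) * c))"
    by (rule sum.swap)
  also have "\<dots> = (\<Sum>h\<in>H. (if h * y = b then of_nat CARD('a) else 0) - 1)"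
    by (simp add: sum_psi_nonzero)
  also have "\<dots> = (\<Sum>h\<in>H. if h * y = b then of_nat CARD('a) else 0) - of_nat (card H)"
    by (simp add: sum_subtractf)
  also have "(\<Sum>h\<in>H. if h * y = b then of_nat CARD('a) else 0)
      = (if y \<noteq> 0 \<and> b / y \<in> H then of_nat CARD('a) else (0::complex))"
  proof (cases "y = 0")
    case False
    then have "h * y = b \<longleftrightarrow> h = b / y" for h by (auto simp: field_simps)
    then show ?thesis using False by (simp add: sum.delta)
  qed (use that in auto)
  finally show ?thesis .
qed

text \<open>Convolving with \<open>\<psi>(- b c)\<close> inverts the period up to the trivial character, whose
  contributions cancel. The result says that all Gauss sums of \<open>\<eta>\<close> times a character trivial
  on \<open>H\<close> coincide.\<close>

lemma sum_eta_psi_H: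
  assumes "c \<noteq> 0"
  shows "(\<Sum>h\<in>H. \<eta> h * \<psi> (c * h)) = (if c \<in> H then gauss_sum * \<eta> c else 0)"
proof -
  \<comment> \<open>With this choice \<open>b * x \<in> H\<close> means that \<open>x\<close> lies
    in the coset \<open>c H\<close>.\<close>
  define b where "b = 1 / c"
  have b: "b \<noteq> 0" using assms by (simp add: b_def)
  have bH: "b \<in> H \<longleftrightarrow> c \<in> H"
    using H_inverse[of c] H_inverse[of b] by (auto simp: b_def divide_inverse)
  let ?q = "of_nat CARD('a) :: complex" and ?n = "of_nat (card H) :: complex"
  have gauss: "gauss_sum = (\<Sum>x\<in>-{0}. \<eta> x * \<psi> x)"
    unfolding gauss_sum_def by (rule sum.mono_neutral_right) auto
  \<comment> \<open>The sum of \<open>\<psi> (- b * c) * gauss_sum * period c\<close> over the bound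
    variable \<open>c\<close> is evaluated twice: directly with \<open>y = 1\<close>, and with
    \<open>y = 1 / x\<close> after expanding by \<open>period_convolution\<close>.\<close>
  have "gauss_sum * ((if b \<in> H then ?q else 0) - ?n)
      = (\<Sum>c\<in>-{0}. \<psi> (- b * c) * (gauss_sum * period c))"
    using arg_cong[OF sum_psi_period[OF b, of 1], of "\<lambda>z. gauss_sum * z"]
    by (simp add: sum_distrib_left mult_ac)
  also have "\<dots> = (\<Sum>c\<in>-{0}. \<psi> (- b * c) * (\<Sum>x\<in>-{0}. \<eta> x * \<psi> x * period (c / x)))"
    by (intro sum.cong) (auto simp: period_convolution)
  also have "\<dots> = (\<Sum>c\<in>-{0}. \<Sum>x\<in>-{0}. \<eta> x * \<psi> x * (\<psi> (- b * c) * period (c * (1 / x))))"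
    by (simp add: sum_distrib_left mult_ac)
  also have "\<dots> = (\<Sum>x\<in>-{0}. \<Sum>c\<in>-{0}. \<eta> x * \<psi> x * (\<psi> (- b * c) * period (c * (1 / x))))"
    by (rule sum.swap)
  also have "\<dots> = (\<Sum>x\<in>-{0}. \<eta> x * \<psi> x * ((if b * x \<in> H then ?q else 0) - ?n))"
    by (intro sum.cong) (simp_all only: sum_psi_period[OF b] flip: sum_distrib_left, auto)
  also have "\<dots> = (\<Sum>x\<in>-{0}. if b * x \<in> H then \<eta> x * \<psi> x * ?q else 0) - gauss_sum * ?n"
    unfolding gauss sum_distrib_right sum_subtractf[symmetric]
    by (intro sum.cong) (auto simp: algebra_simps)
  also have "(\<Sum>x\<in>-{0}. if b * x \<in> H then \<eta> x * \<psi> x * ?q else 0)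
      = (\<Sum>x | x \<noteq> 0 \<and> b * x \<in> H. \<eta> x * \<psi> x * ?q)"
    by (rule sum.mono_neutral_cong_right) auto
  also have "\<dots> = (\<Sum>h\<in>H. \<eta> c * (\<eta> h * \<psi> (c * h)) * ?q)"
    by (rule sum.reindex_bij_witness[of _ "\<lambda>h. c * h" "\<lambda>x. x / c"])
      (use assms H_nonzero in \<open>auto simp: b_def eta_divide\<close>)
  also have "\<dots> = \<eta> c * (\<Sum>h\<in>H. \<eta> h * \<psi> (c * h)) * ?q"
    by (simp add: sum_distrib_left sum_distrib_right)
  finally have "\<eta> c * (\<Sum>h\<in>H. \<eta> h * \<psi> (c * h)) * ?q = (if c \<in> H then gauss_sum else 0) * ?q"
    by (auto simp: bH algebra_simps)
  then have "\<eta> c * (\<Sum>h\<in>H. \<eta> h * \<psi> (c * h)) = (if c \<in> H then gauss_sum else 0)"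
    by simp
  then have "\<eta> c * (\<eta> c * (\<Sum>h\<in>H. \<eta> h * \<psi> (c * h))) = \<eta> c * (if c \<in> H then gauss_sum else 0)"
    by (rule arg_cong)
  then show ?thesis using assms by (cases "c \<in> H") (simp_all add: mult.commute[of gauss_sum])
qed

end

section \<open>Difference sets from the quadratic character twisted by signs on cosets\<close>

context frobenius_coset
begin

context
  fixes g :: "'a \<Rightarrow> complex"
  assumes g_zero: "g 0 = 0"
    and g_sign: "x \<noteq> 0 \<Longrightarrow> g x = 1 \<or> g x = -1"
    and g_coset: "h \<in> H \<Longrightarrow> g (x * h) = g x * \<eta> h"
begin

lemma g_minus: "g (- x) = - g x"
  using g_coset[OF minus_one_in_H, of x] by (simp add: eta_minus_1)

text \<open>Replacing \<open>x\<close> by \<open>x * h\<close> and averaging over \<open>H\<close>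
  produces the inner sum of \<open>sum_eta_psi_H\<close> at \<open>c * x\<close>. Only
  \<open>x\<close> with \<open>c * x \<in> H\<close> survive, and there
  \<open>g x = g (1 / c) * \<eta> (c * x)\<close>, so all surviving terms are equal.\<close>

lemma sum_g_psi: "(\<Sum>x\<in>UNIV. g x * \<psi> (c * x)) = gauss_sum * g (1 / c)"
proof (cases "c = 0")
  \<comment> \<open>The default value \<open>1 / 0 = 0\<close> makes the right-hand side
    \<open>gauss_sum * g 0 = 0\<close>; the left-hand side is the sum of an odd function.\<close>
  case True
  have "(\<Sum>x\<in>UNIV. g x) = (\<Sum>x\<in>UNIV. g (- x))"
    by (rule sum.reindex_bij_witness[of _ uminus uminus]) auto
  then have "(\<Sum>x\<in>UNIV. g x) = 0"
    by (simp add: g_minus sum_negf)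
  then show ?thesis using True by (simp add: psi_zero g_zero)
next
  case False
  let ?n = "of_nat (card H) :: complex"
  have "?n * (\<Sum>x\<in>UNIV. g x * \<psi> (c * x)) = (\<Sum>h\<in>H. \<Sum>x\<in>UNIV. g x * \<psi> (c * x))"
    by simp
  also have "\<dots> = (\<Sum>h\<in>H. \<Sum>x\<in>UNIV. g x * (\<eta> h * \<psi> ((c * x) * h)))"
  proof (rule sum.cong[OF refl])
    fix h assume h: "h \<in> H"
    show "(\<Sum>x\<in>UNIV. g x * \<psi> (c * x)) = (\<Sum>x\<in>UNIV. g x * (\<eta> h * \<psi> ((c * x) * h)))"
    proof (rule sum.reindex_bij_witness[of _ "\<lambda>x. x * h" "\<lambda>x. x / h"])
      fix x
      have "g (x / h) * \<eta> h = g x" "c * (x / h) * h = c * x"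
        using g_coset[OF h, of "x / h"] H_nonzero[OF h] by simp_all
      then show "g (x / h) * (\<eta> h * \<psi> (c * (x / h) * h)) = g x * \<psi> (c * x)"
        by (simp only: mult.assoc[symmetric])
    qed (use H_nonzero[OF h] in auto)
  qed
  also have "\<dots> = (\<Sum>x\<in>UNIV. \<Sum>h\<in>H. g x * (\<eta> h * \<psi> ((c * x) * h)))"
    by (rule sum.swap)
  also have "\<dots> = (\<Sum>x\<in>UNIV. g x * (if c * x \<in> H then gauss_sum * \<eta> (c * x) else 0))"
  proof (rule sum.cong[OF refl])
    fix x
    show "(\<Sum>h\<in>H. g x * (\<eta> h * \<psi> ((c * x) * h)))
        = g x * (if c * x \<in> H then gauss_sum * \<eta> (c * x) else 0)"
      using False sum_eta_psi_H[of "c * x"]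
      by (cases "x = 0") (simp_all add: g_zero flip: sum_distrib_left)
  qed
  also have "\<dots> = (\<Sum>x | c * x \<in> H. g x * (gauss_sum * \<eta> (c * x)))"
    by (rule sum.mono_neutral_cong_right) auto
  also have "\<dots> = (\<Sum>h\<in>H. g (1 / c) * gauss_sum)"
  proof (rule sum.reindex_bij_witness[of _ "\<lambda>h. h / c" "\<lambda>x. c * x"])
    fix x assume x: "x \<in> {x. c * x \<in> H}"
    then have "g x = g (1 / c) * \<eta> (c * x)"
      using g_coset[of "c * x" "1 / c"] False by simp
    then show "g (1 / c) * gauss_sum = g x * (gauss_sum * \<eta> (c * x))"
      using x H_nonzero[of "c * x"] by (simp add: mult_ac)
  qed (use False in auto)
  also have "\<dots> = ?n * (gauss_sum * g (1 / c))" by simp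
  finally show ?thesis using card_H_pos mult_left_cancel[of ?n] by auto
qed

lemma card_gt_1: "CARD('a) > 1"
proof -
  have "card {0, 1 :: 'a} \<le> CARD('a)" by (rule card_mono) auto
  then show ?thesis by simp
qed

text \<open>The condition \<open>y = x + u\<close> is expanded by orthogonality of
  \<open>\<psi>\<close>, which turns the correlation into a sum over \<open>c\<close> of transforms
  at \<open>c\<close> and \<open>- c\<close>. As \<open>g\<close> is odd, their product is
  \<open>- gauss_sum^2 * g (1 / c)^2\<close>, constant off 0.\<close>

lemma autocorrelation:
  "of_nat CARD('a) * (\<Sum>x\<in>UNIV. g x * g (x + u))
     = - gauss_sum\<^sup>2 * ((if u = 0 then of_nat CARD('a) else 0) - 1)"
proof -
  let ?q = "of_nat CARD('a) :: complex"
  have "?q * (\<Sum>x\<in>UNIV. g x * g (x + u))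
      = (\<Sum>x\<in>UNIV. \<Sum>y\<in>UNIV. g x * g y * (if y - x - u = 0 then ?q else 0))"
  proof -
    have "(\<Sum>y\<in>UNIV. g x * g y * (if y - x - u = 0 then ?q else 0)) = ?q * (g x * g (x + u))" for x
    proof -
      have "y - x - u = 0 \<longleftrightarrow> y = x + u" for y by (auto simp: algebra_simps)
      then show ?thesis by (simp add: if_distrib[of "\<lambda>z. _ * z"] cong: if_cong)
    qed
    then show ?thesis by (simp add: sum_distrib_left)
  qed
  also have "\<dots> = (\<Sum>x\<in>UNIV. \<Sum>y\<in>UNIV. \<Sum>c\<in>UNIV. g x * g y * \<psi> ((y - x - u) * c))"
    by (simp only: sum_psi sum_distrib_left[symmetric])
  also have "\<dots> = (\<Sum>x\<in>UNIV. \<Sum>c\<in>UNIV. \<Sum>y\<in>UNIV. g x * g y * \<psi> ((y - x - u) * c))"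
    by (intro sum.cong refl sum.swap)
  also have "\<dots> = (\<Sum>c\<in>UNIV. \<Sum>x\<in>UNIV. \<Sum>y\<in>UNIV. g x * g y * \<psi> ((y - x - u) * c))"
    by (rule sum.swap)
  also have "\<dots> = (\<Sum>c\<in>UNIV. \<psi> (- u * c) * (\<Sum>x\<in>UNIV. g x * \<psi> (- c * x)) * (\<Sum>y\<in>UNIV. g y * \<psi> (c * y)))"
  proof (rule sum.cong[OF refl])
    fix c
    have "\<psi> ((y - x - u) * c) = \<psi> (- u * c) * \<psi> (- c * x) * \<psi> (c * y)" for x y
      by (simp add: algebra_simps flip: psi_add)
    then show "(\<Sum>x\<in>UNIV. \<Sum>y\<in>UNIV. g x * g y * \<psi> ((y - x - u) * c))
        = \<psi> (- u * c) * (\<Sum>x\<in>UNIV. g x * \<psi> (- c * x)) * (\<Sum>y\<in>UNIV. g y * \<psi> (c * y))"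
      by (simp add: sum_distrib_left sum_distrib_right mult_ac)
  qed
  also have "\<dots> = (\<Sum>c\<in>UNIV. \<psi> (- u * c) * (- gauss_sum\<^sup>2) * (g (1 / c))\<^sup>2)"
    unfolding sum_g_psi using g_minus[of "1 / _"]
    by (simp add: power2_eq_square mult_ac)
  also have "\<dots> = (\<Sum>c\<in>-{0}. - gauss_sum\<^sup>2 * \<psi> (- u * c))"
  proof (rule sum.mono_neutral_cong_right)
    fix c :: 'a assume "c \<in> -{0}"
    then have "(g (1 / c))\<^sup>2 = 1" using g_sign[of "1 / c"] by auto
    then show "\<psi> (- u * c) * (- gauss_sum\<^sup>2) * (g (1 / c))\<^sup>2 = - gauss_sum\<^sup>2 * \<psi> (- u * c)"
      by simp
  qed (auto simp: g_zero)
  also have "\<dots> = - gauss_sum\<^sup>2 * ((if u = 0 then ?q else 0) - 1)"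
    unfolding sum_distrib_left[symmetric] sum_psi_nonzero by simp
  finally show ?thesis .
qed

text \<open>The shift \<open>u = 0\<close>, where the correlation is \<open>q - 1\<close> for the
  field size \<open>q\<close>, determines \<open>gauss_sum^2 = - q\<close>; this is then inserted
  for nonzero shifts.\<close>

lemma sum_g_g: "(\<Sum>x\<in>UNIV. g x * g (x + u)) = -1" if "u \<noteq> 0"
proof -
  let ?q = "of_nat CARD('a) :: complex"
  have q: "?q - 1 \<noteq> 0" using card_gt_1 by simp
  have "(\<Sum>x\<in>UNIV. g x * g x) = (\<Sum>x\<in>-{0::'a}. 1)"
    by (rule sum.mono_neutral_cong_right) (use g_zero g_sign in force)+
  also have "\<dots> = ?q - 1"
    using card_gt_1 by (simp add: Compl_eq_Diff_UNIV card_Diff_singleton of_nat_diff)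
  finally have "- gauss_sum\<^sup>2 * (?q - 1) = ?q * (?q - 1)"
    using autocorrelation[of 0] by simp
  then have "- gauss_sum\<^sup>2 = ?q"
    using q mult_right_cancel by blast
  then have "?q * (\<Sum>x\<in>UNIV. g x * g (x + u)) = ?q * (-1)"
    using autocorrelation[of u] that by simp
  moreover have "?q \<noteq> 0" by simp
  ultimately show ?thesis by (metis mult_left_cancel)
qed

text \<open>The indicator of \<open>g x = 1\<close> is half of \<open>g + e\<close>, with
  \<open>e\<close> the indicator of the nonzero elements. Expanding the product gives
  \<open>-1 - g (- u) - g u + (q - 2)\<close> for the field size \<open>q\<close>, and the middle
  terms cancel because \<open>g\<close> is odd.\<close>

lemma card_positive_pairs:
  assumes "u \<noteq> 0"
  shows "4 * card {y. g y = 1 \<and> g (y + u) = 1} + 3 = CARD('a)"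
proof -
  define e :: "'a \<Rightarrow> complex" where "e x = (if x = 0 then 0 else 1)" for x
  have ind: "2 * of_bool (g x = 1) = g x + e x" for x
    using g_sign[of x] g_zero by (auto simp: e_def)
  have shift: "(\<Sum>x\<in>UNIV. f (x + u)) = (\<Sum>x\<in>UNIV. f x)" for f :: "'a \<Rightarrow> complex"
    by (rule sum.reindex_bij_witness[of _ "\<lambda>x. x - u" "\<lambda>x. x + u"]) auto
  have g0: "(\<Sum>x\<in>UNIV. g x) = 0"
    using sum_g_psi[of 0] by (simp add: psi_zero g_zero)
  have ge: "(\<Sum>x\<in>UNIV. g x * e (x + u)) = - g (- u)"
  proof -
    have "(\<Sum>x\<in>UNIV. g x * e (x + u)) = (\<Sum>x\<in>UNIV. g x - (if x = - u then g x else 0))"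
      by (intro sum.cong) (auto simp: e_def add_eq_0_iff2)
    then show ?thesis by (simp add: sum_subtractf g0)
  qed
  have eg: "(\<Sum>x\<in>UNIV. e x * g (x + u)) = - g u"
  proof -
    have "(\<Sum>x\<in>UNIV. e x * g (x + u)) = (\<Sum>x\<in>UNIV. g (x + u) - (if x = 0 then g u else 0))"
      by (intro sum.cong) (auto simp: e_def)
    then show ?thesis by (simp add: sum_subtractf g0 shift)
  qed
  have ee: "(\<Sum>x\<in>UNIV. e x * e (x + u)) = of_nat CARD('a) - 2"
  proof -
    have "(\<Sum>x\<in>UNIV. e x * e (x + u))
        = (\<Sum>x\<in>UNIV. 1 - (if x = 0 then 1 else 0) - (if x = - u then 1 else 0))"
      using assms by (intro sum.cong) (auto simp: e_def add_eq_0_iff2)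
    then show ?thesis by (simp add: sum_subtractf)
  qed
  have "of_nat (card {y. g y = 1 \<and> g (y + u) = 1})
      = (\<Sum>x\<in>UNIV. of_bool (g x = 1) * of_bool (g (x + u) = 1) :: complex)"
    by (simp add: Collect_conj_eq flip: of_bool_conj)
  then have "2 * (2 * of_nat (card {y. g y = 1 \<and> g (y + u) = 1}))
      = (\<Sum>x\<in>UNIV. (2 * of_bool (g x = 1)) * (2 * of_bool (g (x + u) = 1)) :: complex)"
    by (simp only: sum_distrib_left mult_ac)
  also have "\<dots> = (\<Sum>x\<in>UNIV. g x * g (x + u)) + (\<Sum>x\<in>UNIV. g x * e (x + u))
      + (\<Sum>x\<in>UNIV. e x * g (x + u)) + (\<Sum>x\<in>UNIV. e x * e (x + u))"
    unfolding ind by (simp add: algebra_simps sum.distrib)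
  also have "\<dots> = of_nat CARD('a) - 3"
    unfolding sum_g_g[OF assms] ge eg ee by (simp add: g_minus)
  finally have "of_nat (4 * card {y. g y = 1 \<and> g (y + u) = 1} + 3) = (of_nat CARD('a) :: complex)"
    by simp
  then show ?thesis by (simp only: of_nat_eq_iff)
qed

text \<open>A pair with difference \<open>u\<close> is determined by its second entry, so the
  previous count gives \<open>(q - 3) / 4\<close> for the field size \<open>q\<close>. Skewness is
  the oddness of \<open>g\<close>.\<close>

lemma skew_hadamard_positive: "skew_hadamard_difference_set {x. g x = 1}"
proof -
  have count: "card {(x, y). x \<in> {x. g x = 1} \<and> y \<in> {x. g x = 1} \<and> x \<noteq> y \<and> x - y = u}
      = (CARD('a) - 3) div 4" if "u \<noteq> 0" for u
  proof -
    have "bij_betw snd {(x, y). x \<in> {x. g x = 1} \<and> y \<in> {x. g x = 1} \<and> x \<noteq> y \<and> x - y = u}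
        {y. g y = 1 \<and> g (y + u) = 1}"
      by (rule bij_betw_byWitness[where f' = "\<lambda>y. (y + u, y)"]) (use that in auto)
    then show ?thesis using card_positive_pairs[OF that] bij_betw_same_card by fastforce
  qed
  have neg: "uminus ` {x. g x = 1} = {x. g x = -1}"
  proof (intro equalityI subsetI)
    fix x assume "x \<in> {x. g x = -1}"
    then have "- x \<in> {x. g x = 1}" by (simp add: g_minus)
    then show "x \<in> uminus ` {x. g x = 1}" by (metis image_eqI minus_minus)
  qed (auto simp: g_minus)
  have "difference_set CARD('a) (card {x. g x = 1}) ((CARD('a) - 3) div 4) {x. g x = 1}"
    unfolding difference_set_def using count by blast
  moreover have "{x. g x = 1} \<union> {x. g x = -1} \<union> {0} = UNIV"
    using g_sign by blast
  ultimately show ?thesis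
    unfolding skew_hadamard_difference_set_def neg by (auto simp: g_zero)
qed

end

end

section \<open>Cyclotomic classes\<close>

text \<open>Nonnegative exponents suffice: by Euler's theorem the inverse of \<open>p\<close> modulo
  \<open>P\<close> is \<open>p ^ (totient P - 1)\<close>.\<close>

lemma unit_span_powerE:
  assumes "1 < P" "coprime p P" "x \<in> unit_span P p"
  obtains j where "x = int (p ^ j) mod int P"
proof -
  have tot: "[p ^ totient P = 1] (mod P)" using assms(2) by (rule euler_theorem)
  interpret residues "int P" "residue_ring (int P)"
    using assms(1) by (simp_all add: residues_def)
  let ?R = "residue_ring (int P)"
  interpret U: group "units_of ?R" by (rule units_group)
  have unit: "int (p ^ j) mod int P \<in> Units ?R" for j
    using assms(1,2) by (intro mod_in_res_units) (auto simp: coprime_int_iff)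
  have "\<exists>j. x = int (p ^ j) mod int P"
    using assms(3) unfolding unit_span_def
  proof (induction rule: generate.induct)
    case one
    show ?case using assms(1) by (intro exI[of _ 0]) (simp add: units_of_one res_one_eq)
  next
    case (incl h)
    then show ?case by (intro exI[of _ 1]) simp
  next
    case (inv h)
    have "totient P > 0" using assms(1) by simp
    then have "int (p ^ (totient P - 1)) * int p = int (p ^ totient P)"
      by (metis Suc_pred' mult.commute of_nat_mult power_Suc)
    moreover have "int (p ^ totient P) mod int P = 1"
      using tot assms(1) by (metis cong_def mod_less of_nat_1 zmod_int)
    ultimately have "inv\<^bsub>units_of ?R\<^esub> h = int (p ^ (totient P - 1)) mod int P"
      using inv unit[of 1] unit[of "totient P - 1"]
      by (intro U.inv_equality)
        (simp_all add: units_of_mult units_of_carrier units_of_one res_mult_eq res_one_eq mod_mult_eq)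
    then show ?case by blast
  next
    case (eng h1 h2)
    then obtain i j where "h1 = int (p ^ i) mod int P" "h2 = int (p ^ j) mod int P" by blast
    then show ?case
      by (intro exI[of _ "i + j"]) (simp add: units_of_mult res_mult_eq power_add mod_mult_eq)
  qed
  then show ?thesis using that by blast
qed

section \<open>Powers of a primitive element and the quadratic character\<close>

locale primitive_root =
  fixes \<omega> :: "'a::{field,finite}"
  assumes primitive: "primitive_element \<omega>"
    and card_mod_4: "CARD('a) mod 4 = 3"
begin

lemma even_q1: "even (CARD('a) - 1)"
  and odd_half_q1: "odd ((CARD('a) - 1) div 2)"
  and q1_pos: "CARD('a) - 1 > 0"
  using card_mod_4 by presburger+

lemma omega_neq_0 [simp]: "\<omega> \<noteq> 0"
proof
  assume "\<omega> = 0"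
  then have "0 \<in> mult_span \<omega>"
    unfolding mult_span_def by (intro range_eqI[of _ _ 1]) simp
  then show False using primitive by (simp add: primitive_element_def)
qed

lemma mult_span_nat: "mult_span y = range (\<lambda>k::nat. y ^ k)" if "y \<noteq> 0" for y :: 'a
proof
  have y: "y ^ (CARD('a) - 1) = 1" by (rule finite_field_power_card_minus_1[OF that])
  show "mult_span y \<subseteq> range (\<lambda>k::nat. y ^ k)"
  proof
    fix z assume "z \<in> mult_span y"
    then obtain k :: int where k: "z = y powi k" by (auto simp: mult_span_def)
    show "z \<in> range (\<lambda>k::nat. y ^ k)"
    proof (cases "k \<ge> 0")
      case True
      then show ?thesis using k by (auto simp: power_int_def)
    next
      case False
      define n where "n = nat (- k)"
      have "z * y ^ n = 1" using k False that by (simp add: n_def power_int_def flip: power_mult_distrib)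
      \<comment> \<open>The exponent \<open>CARD('a) - 2\<close> represents -1 modulo
        \<open>CARD('a) - 1\<close>.\<close>
      moreover have "y ^ (n * (CARD('a) - 2)) * y ^ n = 1"
      proof -
        have "n * (CARD('a) - 2) + n = (CARD('a) - 1) * n" using q1_pos by (cases "CARD('a) - 1") auto
        then show ?thesis using y by (metis power_add power_mult power_one)
      qed
      ultimately have "z = y ^ (n * (CARD('a) - 2))"
        using that by (metis mult_right_cancel power_not_zero)
      then show ?thesis by blast
    qed
  qed
  show "range (\<lambda>k::nat. y ^ k) \<subseteq> mult_span y"
    unfolding mult_span_def by (metis image_subsetI power_int_of_nat rangeI)
qed

lemma powerE:
  assumes "x \<noteq> 0"
  obtains k where "x = \<omega> ^ k"
  using assms primitive mult_span_nat[OF omega_neq_0] by (auto simp: primitive_element_def)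

text \<open>Exponents below \<open>CARD('a) - 1\<close> already reach all nonzero elements, so by
  counting these powers are distinct.\<close>

lemma power_omega_eq_iff: "\<omega> ^ a = \<omega> ^ b \<longleftrightarrow> [a = b] (mod (CARD('a) - 1))"
proof
  have one: "\<omega> ^ (CARD('a) - 1) = 1" by (rule finite_field_power_card_minus_1) simp
  show "[a = b] (mod (CARD('a) - 1)) \<Longrightarrow> \<omega> ^ a = \<omega> ^ b" by (rule power_eq_of_cong[OF one])
  have reduce: "\<omega> ^ k = \<omega> ^ (k mod (CARD('a) - 1))" for k
    by (rule power_eq_of_cong[OF one]) (simp add: cong_def)
  have "x \<in> (\<lambda>k. \<omega> ^ k) ` {..<CARD('a) - 1}" if "x \<in> -{0}" for x
  proof -
    from that have "x \<noteq> 0" by simp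
    then obtain k where "x = \<omega> ^ k" by (rule powerE)
    then have "x = \<omega> ^ (k mod (CARD('a) - 1))" using reduce by simp
    then show ?thesis using q1_pos by auto
  qed
  then have "(\<lambda>k. \<omega> ^ k) ` {..<CARD('a) - 1} = -{0}" by auto
  then have "card ((\<lambda>k. \<omega> ^ k) ` {..<CARD('a) - 1}) = card {..<CARD('a) - 1}"
    by (simp add: Compl_eq_Diff_UNIV card_Diff_singleton)
  then have inj: "inj_on (\<lambda>k. \<omega> ^ k) {..<CARD('a) - 1}" by (rule eq_card_imp_inj_on[rotated]) simp
  assume "\<omega> ^ a = \<omega> ^ b"
  then have "\<omega> ^ (a mod (CARD('a) - 1)) = \<omega> ^ (b mod (CARD('a) - 1))" using reduce by metis
  then show "[a = b] (mod (CARD('a) - 1))"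
    using inj q1_pos unfolding cong_def by (auto dest: inj_onD)
qed

text \<open>The sign is the parity of a discrete logarithm. Any choice of it gives the same sign,
  since \<open>CARD('a) - 1\<close> is even.\<close>

definition quad_char :: "'a \<Rightarrow> complex" where
  "quad_char x = (if x = 0 then 0 else (-1) ^ (SOME k. \<omega> ^ k = x))"

lemma quad_char_power: "quad_char (\<omega> ^ k) = (-1) ^ k"
proof -
  define l where "l = (SOME l. \<omega> ^ l = \<omega> ^ k)"
  have "\<omega> ^ l = \<omega> ^ k" unfolding l_def by (rule someI) (rule refl)
  then have "[l = k] (mod 2)"
    using even_q1 unfolding power_omega_eq_iff by (rule cong_dvd_modulus_nat)
  then have "even l \<longleftrightarrow> even k" by (simp add: cong_def even_iff_mod_2_eq_zero)
  then show ?thesis unfolding quad_char_def l_def[symmetric] by (simp add: uminus_power_if)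
qed

lemma minus_one_eq_power: "-1 = \<omega> ^ ((CARD('a) - 1) div 2)"
proof -
  have "(\<omega> ^ ((CARD('a) - 1) div 2))\<^sup>2 = \<omega> ^ (CARD('a) - 1)" using even_q1 by (simp flip: power_mult)
  also have "\<dots> = 1" by (rule finite_field_power_card_minus_1) simp
  finally have "\<omega> ^ ((CARD('a) - 1) div 2) = 1 \<or> \<omega> ^ ((CARD('a) - 1) div 2) = -1" by (simp add: power2_eq_1_iff)
  moreover have "\<omega> ^ ((CARD('a) - 1) div 2) \<noteq> \<omega> ^ 0"
  proof -
    have "0 < (CARD('a) - 1) div 2" using odd_half_q1 by (rule odd_pos)
    moreover have "(CARD('a) - 1) div 2 < CARD('a) - 1" using q1_pos by simp
    ultimately show ?thesis unfolding power_omega_eq_iff cong_def by simp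
  qed
  ultimately show ?thesis by simp
qed

lemma quadratic_gauss_quad_char:
  assumes "additive_character \<psi>"
  shows "quadratic_gauss \<psi> quad_char"
proof -
  interpret additive_character \<psi> by fact
  show ?thesis
  proof
    show "quad_char 0 = 0" by (simp add: quad_char_def)
    show "quad_char (x * y) = quad_char x * quad_char y" for x y
    proof (cases "x = 0 \<or> y = 0")
      case False
      then obtain a b where "x = \<omega> ^ a" "y = \<omega> ^ b" by (metis powerE)
      then show ?thesis by (simp add: quad_char_power flip: power_add)
    qed (auto simp: quad_char_def)
    show "quad_char (-1) = -1"
      using odd_half_q1 by (simp add: minus_one_eq_power quad_char_power)
    fix x :: 'a assume "x \<noteq> 0"
    then obtain a where a: "x = \<omega> ^ a" by (rule powerE)
    show "quad_char x = 1 \<or> quad_char x = -1"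
      by (simp add: a quad_char_power uminus_power_if)
    show "quad_char x = 1 \<longleftrightarrow> (\<exists>y. x = y\<^sup>2)"
    proof
      assume "quad_char x = 1"
      then have "even a" by (auto simp: a quad_char_power uminus_power_if split: if_splits)
      then have "x = (\<omega> ^ (a div 2))\<^sup>2" by (simp add: a flip: power_mult)
      then show "\<exists>y. x = y\<^sup>2" ..
    next
      assume "\<exists>y. x = y\<^sup>2"
      then obtain y where y: "x = y\<^sup>2" by blast
      with \<open>x \<noteq> 0\<close> have "y \<noteq> 0" by auto
      then obtain b where "y = \<omega> ^ b" by (rule powerE)
      then have "x = \<omega> ^ (b * 2)" using y by (simp add: power_mult)
      then show "quad_char x = 1" by (simp add: quad_char_power)
    qed
  qed
qed

text \<open>As \<open>N\<close> divides \<open>CARD('a) - 1\<close>, the exponent of a power of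
  \<open>\<omega>\<close> is well defined modulo \<open>N\<close> and names its coset.\<close>

lemma power_in_cyclotomic_union_iff:
  assumes "N dvd CARD('a) - 1" "I \<subseteq> {0..<N}"
  shows "\<omega> ^ a \<in> cyclotomic_union N \<omega> I \<longleftrightarrow> a mod N \<in> I"
proof
  assume "\<omega> ^ a \<in> cyclotomic_union N \<omega> I"
  then obtain i k where i: "i \<in> I" and "\<omega> ^ a = \<omega> ^ i * (\<omega> ^ N) ^ k"
    using mult_span_nat[of "\<omega> ^ N"] by (auto simp: cyclotomic_union_def)
  then have "\<omega> ^ a = \<omega> ^ (i + N * k)" by (simp add: power_add power_mult)
  then have "[a = i + N * k] (mod N)"
    using assms(1) unfolding power_omega_eq_iff by (rule cong_dvd_modulus_nat)
  then have "a mod N = i" using i assms(2) by (auto simp: cong_def)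
  then show "a mod N \<in> I" using i by simp
next
  assume i: "a mod N \<in> I"
  have "\<omega> ^ a = \<omega> ^ (a mod N + N * (a div N))" by simp
  also have "\<dots> = \<omega> ^ (a mod N) * (\<omega> ^ N) ^ (a div N)" by (simp only: power_add power_mult)
  finally show "\<omega> ^ a \<in> cyclotomic_union N \<omega> I"
    using i mult_span_nat[of "\<omega> ^ N"] by (auto simp: cyclotomic_union_def)
qed

end

text \<open>The classes of \<open>a\<close> and \<open>a + P\<close> are the two classes modulo
  \<open>2 * P\<close> above \<open>a mod P\<close>. By cardinality, reduction modulo
  \<open>P\<close> is injective on \<open>I\<close>, so \<open>I\<close> contains exactly one of
  them.\<close>

lemma transversal_mod_2P_shift:
  fixes P :: nat
  assumes "P > 0" "I \<subseteq> {0..<2 * P}" "(\<lambda>i. i mod P) ` I = {0..<P}" "card I = P"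
  shows "(a + P) mod (2 * P) \<in> I \<longleftrightarrow> a mod (2 * P) \<notin> I"
proof -
  have "finite I" using assms(2) finite_subset by blast
  then have inj: "inj_on (\<lambda>i. i mod P) I" using assms(3,4) by (intro eq_card_imp_inj_on) auto
  have cong: "(a mod (2 * P)) mod P = a mod P" "((a + P) mod (2 * P)) mod P = a mod P"
    by (simp_all add: mod_mod_cancel)
  have cases: "c = a mod P \<or> c = a mod P + P" if "c < 2 * P" "c mod P = a mod P" for c
    using that assms(1) by (cases "c < P") (auto simp: le_mod_geq not_less)
  have neq: "(a + P) mod (2 * P) \<noteq> a mod (2 * P)"
  proof
    assume "(a + P) mod (2 * P) = a mod (2 * P)"
    then have "[a + P = a + 0] (mod (2 * P))" by (simp add: cong_def)
    then have "2 * P dvd P" unfolding cong_add_lcancel_nat by (simp add: cong_0_iff)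
    then show False using assms(1) by (auto dest: dvd_imp_le)
  qed
  have "a mod P \<in> (\<lambda>i. i mod P) ` I" using assms(1,3) by simp
  then obtain i where i: "i \<in> I" "i mod P = a mod P" by auto
  have "i < 2 * P" using i(1) assms(2) by auto
  then have "i = a mod (2 * P) \<or> i = (a + P) mod (2 * P)"
    using cases[OF _ i(2)] cases[OF _ cong(1)] cases[OF _ cong(2)] neq assms(1) by force
  moreover have "\<not> (a mod (2 * P) \<in> I \<and> (a + P) mod (2 * P) \<in> I)"
    using inj_onD[OF inj] cong neq by metis
  ultimately show ?thesis using i(1) by auto
qed

lemma transversal_mod_2P_shift_multiple:
  fixes P :: nat
  assumes "P > 0" "I \<subseteq> {0..<2 * P}" "(\<lambda>i. i mod P) ` I = {0..<P}" "card I = P"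
  shows "(a + b * P) mod (2 * P) \<in> I \<longleftrightarrow> (even b \<longleftrightarrow> a mod (2 * P) \<in> I)"
proof (induction b)
  case (Suc b)
  have "a + Suc b * P = (a + b * P) + P" by simp
  then show ?case
    using transversal_mod_2P_shift[OF assms, of "a + b * P"] by (simp only: Suc.IH even_Suc) blast
qed simp

section \<open>The difference set from a transversal of cyclotomic classes\<close>

theorem theorem4p1:
  fixes p\<^sub>1 m N p f s q :: nat
    and \<omega> :: "'a::{field,finite}"
    and I :: "nat set"
  assumes "prime p\<^sub>1" and "m \<ge> 1" and "N = 2 * p\<^sub>1 ^ m"
    and "prime p" and "[p = 3] (mod 4)"
    and "coprime p (p\<^sub>1 ^ m)" and "2 mod int (p\<^sub>1 ^ m) \<in> unit_span (p\<^sub>1 ^ m) p"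
    and "gcd p\<^sub>1 (p - 1) = 1"
    and "f = ord N p" and "odd f"
    and "odd s" and "q = p ^ (f * s)"
    and "CARD('a) = q" and "primitive_element \<omega>"
    and "I \<subseteq> {0..<N}" and "(\<lambda>i. i mod p\<^sub>1 ^ m) ` I = {0..<p\<^sub>1 ^ m}" and "card I = p\<^sub>1 ^ m"
  shows "skew_hadamard_difference_set (cyclotomic_union N \<omega> I)"
proof -
  define P where "P = p\<^sub>1 ^ m"
  have N: "N = 2 * P" using assms(3) by (simp add: P_def)
  have p3: "p mod 4 = 3" using assms(5) by (simp add: cong_def)
  have P1: "P > 1" unfolding P_def using prime_gt_1_nat[OF assms(1)] assms(2) by (intro one_less_power) auto
  have "odd p\<^sub>1"
  proof
    assume "even p\<^sub>1"
    moreover have "even (p - 1)" using p3 by presburger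
    ultimately have "2 dvd gcd p\<^sub>1 (p - 1)" by (rule gcd_greatest)
    then show False unfolding assms(8) by simp
  qed
  then have oddP: "odd P" by (simp add: P_def)
  have fs: "odd (f * s)" "f * s > 0" using assms(10,11) by (simp_all add: odd_pos)
  \<comment> \<open>The odd exponent \<open>f * s\<close> thus gives \<open>q\<close> the residue 3
    modulo 4, so that -1 is a nonsquare.\<close>
  have "p ^ k mod 4 = (if even k then 1 else 3)" for k
  proof (induction k)
    case (Suc k)
    have "p ^ Suc k mod 4 = (3 * (p ^ k mod 4)) mod 4"
      using p3 by (metis mod_mult_left_eq mod_mult_right_eq power_Suc)
    then show ?case using Suc by simp
  qed simp
  then have "CARD('a) mod 4 = 3" using assms(12,13) fs by simp
  then interpret primitive_root \<omega> using assms(14) by unfold_locales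

  have card: "CARD('a) = p ^ (f * s)" using assms(12,13) by simp
  have char: "CHAR('a) = p" by (rule finite_field_CHAR[OF assms(4) card])
  have pc: "prime CHAR('a)" using char assms(4) by simp
  have "[p ^ (f * s) = 1] (mod N)" unfolding ord_divides using assms(9) by simp
  then have Nq1: "N dvd CARD('a) - 1" unfolding card using assms(4) prime_gt_0_nat
    by (metis cong_to_1_nat)

  obtain \<psi> :: "'a \<Rightarrow> complex" where psi: "additive_character \<psi>" "\<And>x. \<psi> (x ^ p) = \<psi> x"
    using exists_trace_character[OF assms(4) fs(2) card] by blast
  interpret quadratic_gauss \<psi> quad_char by (rule quadratic_gauss_quad_char[OF psi(1)])

  obtain j where "2 mod int P = int (p ^ j) mod int P"
    using unit_span_powerE[OF P1] assms(6,7) unfolding P_def by blast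
  then have "int (2 mod P) = int (p ^ j mod P)" by (simp only: zmod_int of_nat_numeral)
  then have "[2 = p ^ j] (mod P)" by (simp only: cong_def of_nat_eq_iff)
  \<comment> \<open>Adding multiples of \<open>P\<close> on both sides expresses the congruence in
    naturals without subtraction.\<close>
  then obtain k l where kl: "p ^ j + k * P = 2 + l * P"
    unfolding cong_iff_lin_nat by blast

  define H :: "'a set" where "H = (\<lambda>x. x ^ P) ` (-{0})"
  \<comment> \<open>As 2 lies in the prime field, \<open>2 ^ (p - 1) = 1\<close>. With
    \<open>a\<close> inverse to \<open>P\<close> modulo \<open>p - 1\<close>, 2 is the
    \<open>P\<close>-th power of \<open>2 ^ a\<close>.\<close>
  have two_in_H: "2 \<in> H"
  proof -
    have "(2::'a) ^ p = 2 * 1"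
      using freshmans_dream[OF pc refl, of 1 1] by (simp add: char)
    moreover have "(2::'a) ^ p = 2 * 2 ^ (p - 1)"
      using assms(4) prime_gt_0_nat[of p] by (metis Suc_pred' power_Suc)
    ultimately have "(2::'a) ^ (p - 1) = 1" by simp
    moreover obtain a where "[P * a = Suc 0] (mod (p - 1))"
    proof -
      have "coprime p\<^sub>1 (p - 1)" using assms(8) by (simp only: coprime_iff_gcd_eq_1)
      then have "coprime P (p - 1)" unfolding P_def by simp
      then show ?thesis using cong_solve_coprime_nat that by blast
    qed
    ultimately have "(2::'a) ^ (P * a) = 2 ^ Suc 0" by (rule power_eq_of_cong)
    then have "2 = ((2::'a) ^ a) ^ P" by (simp add: mult.commute flip: power_mult)
    then show ?thesis unfolding H_def by (intro image_eqI[of _ _ "2 ^ a"]) auto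
  qed
  have H_power: "\<exists>a. a \<noteq> 0 \<and> x = a ^ P" if "x \<in> H" for x
    using that unfolding H_def by blast
  have H_mult: "x * y \<in> H" if "x \<in> H" "y \<in> H" for x y
  proof -
    obtain a b where "x = a ^ P" "y = b ^ P" "a \<noteq> 0" "b \<noteq> 0" using H_power \<open>x \<in> H\<close> \<open>y \<in> H\<close> by metis
    then show ?thesis unfolding H_def by (intro image_eqI[of _ _ "a * b"]) (auto simp: power_mult_distrib)
  qed
  interpret frobenius_coset \<psi> quad_char H "\<lambda>x. x ^ (p ^ j)"
  proof
    show "0 \<notin> H" "1 \<in> H" using P1 by (auto simp: H_def intro!: image_eqI[of _ _ 1])
    show "4 \<in> H" using H_mult[OF two_in_H two_in_H] by simp
    show "-1 \<in> H" using oddP by (auto simp: H_def intro!: image_eqI[of _ _ "-1"])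
    show "x * y \<in> H" if "x \<in> H" "y \<in> H" for x y using that by (rule H_mult)
    show "inverse x \<in> H" if "x \<in> H" for x
    proof -
      obtain a where "x = a ^ P" "a \<noteq> 0" using H_power \<open>x \<in> H\<close> by metis
      then show ?thesis unfolding H_def by (intro image_eqI[of _ _ "inverse a"]) (auto simp: power_inverse)
    qed
    show "0 ^ (p ^ j) = (0::'a)" using assms(4) prime_gt_0_nat by (simp add: power_0_left)
    have "inj (\<lambda>x::'a. x ^ (p ^ j))"
    proof (rule injI)
      fix x y :: 'a
      assume eq: "x ^ (p ^ j) = y ^ (p ^ j)"
      have "((x - y) + y) ^ (p ^ j) = (x - y) ^ (p ^ j) + y ^ (p ^ j)"
        by (rule freshmans_dream'[OF pc]) (simp add: char)
      then have "(x - y) ^ (p ^ j) = 0" using eq by simp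
      then show "x = y" by simp
    qed
    then show "bij (\<lambda>x::'a. x ^ (p ^ j))" by (simp add: bij_def finite_UNIV_inj_surj)
    show "\<psi> (x ^ (p ^ j)) = \<psi> x" for x
    proof (induction j)
      case (Suc j)
      have "x ^ (p ^ Suc j) = (x ^ (p ^ j)) ^ p" by (simp add: mult.commute flip: power_mult)
      then show ?case using Suc psi(2) by simp
    qed simp
    fix x :: 'a assume "x \<noteq> 0"
    \<comment> \<open>The equation \<open>kl\<close>, read in exponents of \<open>x\<close>, shows
      that \<open>x ^ (p ^ j)\<close> and \<open>x^2\<close> differ by a \<open>P\<close>-th
      power.\<close>
    have "x ^ (p ^ j) * (x ^ k) ^ P = x\<^sup>2 * (x ^ l) ^ P"
      using kl by (metis power_add power_mult)
    then have "x ^ (p ^ j) / x\<^sup>2 = (x ^ l / x ^ k) ^ P"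
      using \<open>x \<noteq> 0\<close> by (simp add: power_divide frac_eq_eq mult.commute)
    then show "x ^ (p ^ j) / x\<^sup>2 \<in> H"
      using \<open>x \<noteq> 0\<close> unfolding H_def by (intro image_eqI[of _ _ "x ^ l / x ^ k"]) auto
  qed

  define D where "D = cyclotomic_union N \<omega> I"
  define g :: "'a \<Rightarrow> complex" where "g x = (if x = 0 then 0 else if x \<in> D then 1 else -1)" for x
  have "0 \<notin> D" by (auto simp: D_def cyclotomic_union_def mult_span_nat)
  have g_power: "g (\<omega> ^ a) = (if a mod N \<in> I then 1 else -1)" for a
    using power_in_cyclotomic_union_iff[OF Nq1 assms(15)] by (simp add: g_def D_def)
  have "skew_hadamard_difference_set {x. g x = 1}"
  proof (rule skew_hadamard_positive)
    show "g 0 = 0" by (simp add: g_def)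
    show "g x = 1 \<or> g x = -1" if "x \<noteq> 0" for x using that by (simp add: g_def)
    show "g (x * h) = g x * quad_char h" if "h \<in> H" for x h
    proof (cases "x = 0")
      case False
      then obtain a where a: "x = \<omega> ^ a" by (rule powerE)
      obtain y where "y \<noteq> 0" "h = y ^ P" using H_power \<open>h \<in> H\<close> by metis
      then obtain b where b: "h = \<omega> ^ (b * P)" by (metis powerE power_mult)
      \<comment> \<open>Multiplication by \<open>h\<close> shifts the exponent by \<open>P\<close>
        exactly \<open>b\<close> times, each time switching membership in \<open>I\<close>. The
        resulting sign \<open>(-1) ^ b\<close> is \<open>quad_char h\<close>, because
        \<open>P\<close> is odd.\<close>
      have "(a + b * P) mod N \<in> I \<longleftrightarrow> (even b \<longleftrightarrow> a mod N \<in> I)"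
        unfolding N using P1
        by (intro transversal_mod_2P_shift_multiple assms(15)[unfolded N] assms(16,17)[folded P_def]) simp
      moreover have "x * h = \<omega> ^ (a + b * P)" by (simp add: a b power_add)
      ultimately show ?thesis
        using oddP by (simp add: a b g_power quad_char_power uminus_power_if)
    qed (simp add: g_def)
  qed
  moreover have "{x. g x = 1} = D" using \<open>0 \<notin> D\<close> by (auto simp: g_def)
  ultimately show ?thesis by (simp add: D_def)
qed

end
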